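(* If $A\leq_{wtt}B$ and $B\in\mathcal{KT}(\Delta^0_2)$, then $A\in\mathcal{KT}(\Delta^0_2)$.
   Context: Reals are elements of $2^{\omega}$ (infinite binary sequences); $A\upharpoonright n$ is the initial segment of $A$ of length $n$. $K(\sigma)$ is the prefix-free Kolmogorov complexity of the finite binary string $\sigma$ with respect to a fixed universal prefix-free machine, and for $n \in \omega$, $K(n)$ denotes the complexity of the string of $n$ zeros. An order is a function $g:\omega\to\omega$ that is nondecreasing and unbounded (not necessarily recursive). For $g:\omega\to\omega$, $\mathcal{KT}(g)$ is the set of reals $A$ for which there is a constant $c$ such that for all $n\in\omega$, $K(A\upharpoonright n)\leq K(n)+g(n)+c$. $\mathcal{KT}(\Delta^0_2)$ is the intersection of $\mathcal{KT}(g)$ over all $\Delta^0_2$ orders $g$. $A\leq_{wtt}B$ ($A$ is weak truth-table reducible to $B$) means that there are a Turing functional $\Phi$ and a recursive function $f$ such that $\Phi^B=A$ and, for every $n$, the use of the computation of the $n$th bit of $A$ from $B$ (the largest bit of $B$ queried) is at most $f(n)$. *)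

theory Defs
  imports Main "HOL-Library.Sublist"
begin

text \<open>
  Kleene's schemes for partial recursive functions, with \<open>Query\<close> for the characteristic
  function of the oracle. A program acts on the list of its arguments. \<open>Prec f g\<close> recurses
  on the first argument, with base case \<open>f\<close> and step \<open>g\<close>; \<open>Mu f\<close> searches over the
  first argument of \<open>f\<close>.
\<close>

datatype prog =
    Zero
  | Succ
  | Proj nat
  | Query
  | Comp prog "prog list"
  | Prec prog prog
  | Mu prog

text \<open>
  \<open>computes X e xs y Q\<close>: with oracle \<open>X\<close>, program \<open>e\<close> halts on the arguments \<open>xs\<close>
  with value \<open>y\<close>, and \<open>Q\<close> is the set of bits of \<open>X\<close> queried during the computation.
\<close>

inductive computes :: "(nat \<Rightarrow> bool) \<Rightarrow> prog \<Rightarrow> nat list \<Rightarrow> nat \<Rightarrow> nat set \<Rightarrow> bool"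
  for X :: "nat \<Rightarrow> bool" where
  zero: "computes X Zero xs 0 {}"
| succ: "computes X Succ [x] (Suc x) {}"
| proj: "i < length xs \<Longrightarrow> computes X (Proj i) xs (xs ! i) {}"
| query: "computes X Query [x] (of_bool (X x)) {x}"
| comp: "length ys = length gs \<Longrightarrow> length Qs = length gs \<Longrightarrow>
    (\<And>i. i < length gs \<Longrightarrow> computes X (gs ! i) xs (ys ! i) (Qs ! i)) \<Longrightarrow>
    computes X f ys y Q \<Longrightarrow>
    computes X (Comp f gs) xs y (\<Union> (set Qs) \<union> Q)"
| prec_0: "computes X f xs y Q \<Longrightarrow> computes X (Prec f g) (0 # xs) y Q"
| prec_Suc: "computes X (Prec f g) (n # xs) r Q \<Longrightarrow>
    computes X g (n # r # xs) y Q' \<Longrightarrow>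
    computes X (Prec f g) (Suc n # xs) y (Q \<union> Q')"
| mu: "(\<And>k. k < n \<Longrightarrow> computes X f (k # xs) (Suc (r k)) (Q k)) \<Longrightarrow>
    computes X f (n # xs) 0 (Q n) \<Longrightarrow>
    computes X (Mu f) xs n (\<Union>k\<le>n. Q k)"

primrec query_free :: "prog \<Rightarrow> bool" where
  "query_free Zero \<longleftrightarrow> True"
| "query_free Succ \<longleftrightarrow> True"
| "query_free (Proj i) \<longleftrightarrow> True"
| "query_free Query \<longleftrightarrow> False"
| "query_free (Comp f gs) \<longleftrightarrow> query_free f \<and> list_all id (map query_free gs)"
| "query_free (Prec f g) \<longleftrightarrow> query_free f \<and> query_free g"
| "query_free (Mu f) \<longleftrightarrow> query_free f"

text \<open>For a query-free program the oracle is irrelevant, and no bit is queried.\<close>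

definition halts_with :: "prog \<Rightarrow> nat list \<Rightarrow> nat \<Rightarrow> bool" where
  "halts_with e xs y \<longleftrightarrow> computes (\<lambda>_. False) e xs y {}"

definition recursive :: "nat \<Rightarrow> (nat list \<Rightarrow> nat) \<Rightarrow> bool" where
  "recursive k F \<longleftrightarrow>
    (\<exists>e. query_free e \<and> (\<forall>xs. length xs = k \<longrightarrow> halts_with e xs (F xs)))"

definition recursive_fun :: "(nat \<Rightarrow> nat) \<Rightarrow> bool" where
  "recursive_fun f \<longleftrightarrow> recursive 1 (\<lambda>xs. f (xs ! 0))"

definition recursive_rel :: "nat \<Rightarrow> (nat list \<Rightarrow> bool) \<Rightarrow> bool" where
  "recursive_rel k P \<longleftrightarrow> recursive k (\<lambda>xs. of_bool (P xs))"

definition Sigma02 :: "(nat \<Rightarrow> nat \<Rightarrow> bool) \<Rightarrow> bool" where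
  "Sigma02 R \<longleftrightarrow>
    (\<exists>P. recursive_rel 4 P \<and> (\<forall>x y. R x y \<longleftrightarrow> (\<exists>u. \<forall>v. P [u, v, x, y])))"

definition Pi02 :: "(nat \<Rightarrow> nat \<Rightarrow> bool) \<Rightarrow> bool" where
  "Pi02 R \<longleftrightarrow>
    (\<exists>P. recursive_rel 4 P \<and> (\<forall>x y. R x y \<longleftrightarrow> (\<forall>u. \<exists>v. P [u, v, x, y])))"

definition Delta02_fun :: "(nat \<Rightarrow> nat) \<Rightarrow> bool" where
  "Delta02_fun g \<longleftrightarrow> Sigma02 (\<lambda>n m. g n = m) \<and> Pi02 (\<lambda>n m. g n = m)"

definition is_order :: "(nat \<Rightarrow> nat) \<Rightarrow> bool" where
  "is_order g \<longleftrightarrow> mono g \<and> (\<forall>m. \<exists>n. m < g n)"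

text \<open>
  Strings are lists of bits, with \<open>False\<close> for 0 and \<open>True\<close> for 1. The following bijection
  with the natural numbers is bijective base-2 notation, least significant digit first.
\<close>

fun str_code :: "bool list \<Rightarrow> nat" where
  "str_code [] = 0"
| "str_code (b # \<sigma>) = 2 * str_code \<sigma> + (if b then 2 else 1)"

definition partial_recursive_str :: "(bool list \<Rightarrow> bool list option) \<Rightarrow> bool" where
  "partial_recursive_str M \<longleftrightarrow>
    (\<exists>e. query_free e \<and>
      (\<forall>\<sigma> \<tau>. M \<sigma> = Some \<tau> \<longleftrightarrow> halts_with e [str_code \<sigma>] (str_code \<tau>)))"

definition prefix_free_machine :: "(bool list \<Rightarrow> bool list option) \<Rightarrow> bool" where
  "prefix_free_machine M \<longleftrightarrow> partial_recursive_str M \<and>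
    (\<forall>\<sigma>\<in>dom M. \<forall>\<tau>\<in>dom M. prefix \<sigma> \<tau> \<longrightarrow> \<sigma> = \<tau>)"

text \<open>The equation is between partial functions: both sides may be undefined.\<close>

definition universal_prefix_free_machine :: "(bool list \<Rightarrow> bool list option) \<Rightarrow> bool" where
  "universal_prefix_free_machine U \<longleftrightarrow> prefix_free_machine U \<and>
    (\<forall>M. prefix_free_machine M \<longrightarrow> (\<exists>\<rho>. \<forall>\<sigma>. U (\<rho> @ \<sigma>) = M \<sigma>))"

text \<open>A universal \<open>U\<close> is surjective, so that the minimum is then over a nonempty set.\<close>

definition K :: "(bool list \<Rightarrow> bool list option) \<Rightarrow> bool list \<Rightarrow> nat" where
  "K U \<sigma> = (LEAST k. \<exists>\<tau>. U \<tau> = Some \<sigma> \<and> length \<tau> = k)"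

definition initial_segment :: "(nat \<Rightarrow> bool) \<Rightarrow> nat \<Rightarrow> bool list" where
  "initial_segment A n = map A [0..<n]"

text \<open>The complexity of a number \<open>n\<close> is that of the string of \<open>n\<close> zeros.\<close>

definition KT :: "(bool list \<Rightarrow> bool list option) \<Rightarrow> (nat \<Rightarrow> nat) \<Rightarrow> (nat \<Rightarrow> bool) set" where
  "KT U g =
    {A. \<exists>c. \<forall>n. K U (initial_segment A n) \<le> K U (replicate n False) + g n + c}"

definition KT_Delta02 :: "(bool list \<Rightarrow> bool list option) \<Rightarrow> (nat \<Rightarrow> bool) set" where
  "KT_Delta02 U = (\<Inter>g \<in> {g. is_order g \<and> Delta02_fun g}. KT U g)"

text \<open>A Turing functional is given by an oracle program; the use bound is on every queried bit.\<close>

definition wtt_reducible :: "(nat \<Rightarrow> bool) \<Rightarrow> (nat \<Rightarrow> bool) \<Rightarrow> bool" (infix \<open>\<le>\<^sub>w\<^sub>t\<^sub>t\<close> 50) where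
  "A \<le>\<^sub>w\<^sub>t\<^sub>t B \<longleftrightarrow>
    (\<exists>\<Phi> f. recursive_fun f \<and>
      (\<forall>n. \<exists>Q. computes B \<Phi> [n] (of_bool (A n)) Q \<and> (\<forall>q\<in>Q. q \<le> f n)))"

end

theory Submission
  imports Defs
begin

text \<open>
  Let \<open>f\<close> bound the use of the reduction, and let \<open>F n\<close> be a strictly increasing recursive
  function above \<open>f 0, \<dots>, f (n - 1)\<close>. It has a recursive nondecreasing left inverse \<open>u\<close>, so for a
  \<open>\<Delta>\<^sup>0\<^sub>2\<close> order \<open>g\<close> the function \<open>g \<circ> u\<close> is again one. The first \<open>F n\<close> bits of \<open>B\<close>
  determine \<open>n = u (F n)\<close> and then, by running the reduction, the first \<open>n\<close> bits of \<open>A\<close>.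
  Up to additive constants, the complexity of the latter is therefore at most that of the former,
  hence at most \<open>K (F n) + g (u (F n)) \<le> K n + g n\<close>. Both constants come from running a program
  on the output of the universal machine, which preserves prefix-freeness of the domain.
\<close>

section \<open>Evaluation of programs\<close>

inductive_cases computes_ZeroE: "computes X Zero xs y Q"
inductive_cases computes_SuccE: "computes X Succ xs y Q"
inductive_cases computes_ProjE: "computes X (Proj i) xs y Q"
inductive_cases computes_QueryE: "computes X Query xs y Q"
inductive_cases computes_CompE: "computes X (Comp f gs) xs y Q"
inductive_cases computes_Prec_0E: "computes X (Prec f g) (0 # xs) y Q"
inductive_cases computes_Prec_SucE: "computes X (Prec f g) (Suc n # xs) y Q"
inductive_cases computes_MuE: "computes X (Mu f) xs y Q"

lemma computes_functional:
  assumes "computes X e xs y Q" and "computes X e xs y' Q'"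
  shows "y = y'"
  using assms
proof (induction arbitrary: y' Q' rule: computes.induct)
  case (comp ys gs Qs xs f y Q)
  from comp.prems obtain ys' Qs' Q'' where *: "length ys' = length gs"
    "\<And>i. i < length gs \<Longrightarrow> computes X (gs ! i) xs (ys' ! i) (Qs' ! i)"
    "computes X f ys' y' Q''"
    by (elim computes_CompE) blast
  have "ys ! i = ys' ! i" if "i < length gs" for i
    using comp.IH(1)[OF that *(2)[OF that]] .
  then have "ys = ys'"
    using comp.hyps(1) *(1) by (simp add: list_eq_iff_nth_eq)
  then show ?case using comp.IH(2) *(3) by blast
next
  case (prec_Suc f g n xs r Q y Q2)
  then show ?case by (elim computes_Prec_SucE) blast
next
  case (mu n f xs r Q)
  from mu.prems obtain r' P where *:
    "\<And>k. k < y' \<Longrightarrow> computes X f (k # xs) (Suc (r' k)) (P k)"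
    "computes X f (y' # xs) 0 (P y')"
    by (elim computes_MuE) blast
  \<comment> \<open>Searches that stop at different points disagree at the smaller one, where one
    gives 0 and the other a successor.\<close>
  show ?case
  proof (rule linorder_cases[of n y'])
    assume "n < y'"
    then show ?thesis using *(1) mu.IH(2) by fastforce
  next
    assume "y' < n"
    then show ?thesis using *(2) mu.IH(1) by fastforce
  qed
qed (blast elim: computes_ZeroE computes_SuccE computes_ProjE computes_QueryE computes_Prec_0E)+

text \<open>Evaluation is functional, so one computed value yields an equivalence, the form in which
  simp can evaluate composite programs.\<close>

lemma halts_with_iff: "halts_with e xs y \<Longrightarrow> halts_with e xs z \<longleftrightarrow> z = y"
  unfolding halts_with_def by (auto dest: computes_functional)

lemma halts_with_Zero [simp]: "halts_with Zero xs y \<longleftrightarrow> y = 0"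
  unfolding halts_with_def by (auto intro: computes.zero elim: computes_ZeroE)

lemma halts_with_Succ [simp]: "halts_with Succ xs y \<longleftrightarrow> (\<exists>x. xs = [x] \<and> y = Suc x)"
  unfolding halts_with_def by (auto intro: computes.succ elim: computes_SuccE)

lemma halts_with_Proj [simp]: "halts_with (Proj i) xs y \<longleftrightarrow> i < length xs \<and> y = xs ! i"
  unfolding halts_with_def by (auto intro: computes.proj elim: computes_ProjE)

lemma halts_with_Comp [simp]:
  "halts_with (Comp f gs) xs y \<longleftrightarrow>
    (\<exists>ys. list_all2 (\<lambda>g. halts_with g xs) gs ys \<and> halts_with f ys y)"
proof
  assume "halts_with (Comp f gs) xs y"
  then have "computes (\<lambda>_. False) (Comp f gs) xs y {}"
    by (simp add: halts_with_def)
  then show "\<exists>ys. list_all2 (\<lambda>g. halts_with g xs) gs ys \<and> halts_with f ys y"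
  proof (rule computes_CompE)
    fix ys Qs Q
    assume *: "{} = \<Union> (set Qs) \<union> Q" "length ys = length gs" "length Qs = length gs"
      "\<And>i. i < length gs \<Longrightarrow> computes (\<lambda>_. False) (gs ! i) xs (ys ! i) (Qs ! i)"
      "computes (\<lambda>_. False) f ys y Q"
    \<comment> \<open>An empty union of query sets forces each of them to be empty, as
      \<open>halts_with\<close> demands.\<close>
    have "Qs ! i = {}" if "i < length gs" for i
      using that *(1,3) nth_mem[of i Qs] by auto
    then show "\<exists>ys. list_all2 (\<lambda>g. halts_with g xs) gs ys \<and> halts_with f ys y"
      using * by (intro exI[of _ ys]) (auto simp: halts_with_def list_all2_conv_all_nth)
  qed
next
  assume "\<exists>ys. list_all2 (\<lambda>g. halts_with g xs) gs ys \<and> halts_with f ys y"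
  then obtain ys where *: "list_all2 (\<lambda>g. halts_with g xs) gs ys" "halts_with f ys y"
    by blast
  have "computes (\<lambda>_. False) (Comp f gs) xs y (\<Union> (set (replicate (length gs) {})) \<union> {})"
    by (rule computes.comp[of ys])
      (use * in \<open>auto simp: halts_with_def list_all2_conv_all_nth\<close>)
  then show "halts_with (Comp f gs) xs y"
    unfolding halts_with_def by (cases "gs = []") (simp_all add: set_replicate_conv_if)
qed

declare list_all2_Cons1 [simp]

lemma halts_with_Prec:
  assumes "halts_with f xs (r 0)"
    and "\<And>k. k < n \<Longrightarrow> halts_with g (k # r k # xs) (r (Suc k))"
  shows "halts_with (Prec f g) (n # xs) (r n)"
  using assms(2)
proof (induction n)
  case 0
  then show ?case using assms(1) by (simp add: halts_with_def computes.prec_0)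
next
  case (Suc n)
  then have "computes (\<lambda>_. False) (Prec f g) (n # xs) (r n) {}"
    "computes (\<lambda>_. False) g (n # r n # xs) (r (Suc n)) {}"
    by (auto simp: halts_with_def)
  from computes.prec_Suc[OF this] show ?case by (simp add: halts_with_def)
qed

lemma halts_with_Mu:
  assumes "\<And>k. k \<le> n \<Longrightarrow> halts_with f (k # xs) (F k)"
    and "F n = 0" and "\<And>k. k < n \<Longrightarrow> F k \<noteq> 0"
  shows "halts_with (Mu f) xs n"
proof -
  have "computes (\<lambda>_. False) (Mu f) xs n (\<Union>k\<le>n. {})"
  proof (rule computes.mu)
    show "computes (\<lambda>_. False) f (k # xs) (Suc (F k - 1)) {}" if "k < n" for k
      using assms(1,3)[of k] that by (simp add: halts_with_def)
    show "computes (\<lambda>_. False) f (n # xs) 0 {}"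
      using assms(1)[of n] assms(2) by (simp add: halts_with_def)
  qed
  then show ?thesis by (simp add: halts_with_def)
qed

lemma halts_with_MuD: "halts_with (Mu f) xs n \<Longrightarrow> halts_with f (n # xs) 0"
  unfolding halts_with_def
proof (erule computes_MuE)
  fix r Q
  assume "{} = (\<Union>k\<le>n. Q k)" "computes (\<lambda>_. False) f (n # xs) 0 (Q n)"
  moreover from this(1) have "Q n = {}" by auto
  ultimately show "computes (\<lambda>_. False) f (n # xs) 0 {}" by simp
qed

section \<open>Programs for arithmetic\<close>

definition pred_prog :: prog where
  "pred_prog = Prec Zero (Proj 0)"

definition add_prog :: prog where
  "add_prog = Prec (Proj 0) (Comp Succ [Proj 1])"

text \<open>\<open>Prec\<close> recurses on the first argument, so the subtrahend comes first.\<close>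

definition monus_prog :: prog where
  "monus_prog = Prec (Proj 0) (Comp pred_prog [Proj 1])"

definition double_prog :: prog where
  "double_prog = Comp add_prog [Proj 0, Proj 0]"

primrec const_prog :: "nat \<Rightarrow> prog" where
  "const_prog 0 = Zero"
| "const_prog (Suc n) = Comp Succ [const_prog n]"

lemma query_free_arith [simp]:
  "query_free pred_prog" "query_free add_prog" "query_free monus_prog" "query_free double_prog"
  by (simp_all add: pred_prog_def add_prog_def monus_prog_def double_prog_def)

lemma query_free_const [simp]: "query_free (const_prog n)"
  by (induction n) auto

lemma halts_with_pred [simp]: "halts_with pred_prog [x] z \<longleftrightarrow> z = x - 1"
  unfolding pred_prog_def
  by (rule halts_with_iff, rule halts_with_Prec[where r = "\<lambda>k. k - 1"]) auto

lemma halts_with_add [simp]: "halts_with add_prog [x, y] z \<longleftrightarrow> z = x + y"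
  unfolding add_prog_def
  by (rule halts_with_iff, rule halts_with_Prec[where r = "\<lambda>k. k + y"]) auto

lemma halts_with_monus [simp]: "halts_with monus_prog [x, y] z \<longleftrightarrow> z = y - x"
  unfolding monus_prog_def
  by (rule halts_with_iff, rule halts_with_Prec[where r = "\<lambda>k. y - k"]) auto

lemma halts_with_double [simp]: "halts_with double_prog [x] z \<longleftrightarrow> z = 2 * x"
  by (auto simp: double_prog_def)

lemma halts_with_const [simp]: "halts_with (const_prog n) xs z \<longleftrightarrow> z = n"
  by (induction n arbitrary: z) auto

section \<open>Programs acting on codes of strings\<close>

lemma str_code_eq_0_iff [simp]: "str_code \<sigma> = 0 \<longleftrightarrow> \<sigma> = []"
  by (cases \<sigma>) auto

text \<open>The parity of a nonzero code determines the first bit, and then the code of the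
  tail.\<close>

lemma inj_str_code: "inj str_code"
proof (rule injI)
  show "str_code \<sigma> = str_code \<tau> \<Longrightarrow> \<sigma> = \<tau>" for \<sigma> \<tau>
  proof (induction \<sigma> arbitrary: \<tau>)
    case Nil
    then show ?case by (metis str_code_eq_0_iff)
  next
    case (Cons b \<sigma>)
    then obtain b' \<tau>' where \<tau>: "\<tau> = b' # \<tau>'"
      by (metis list.exhaust str_code_eq_0_iff)
    have "b = b' \<and> str_code \<sigma> = str_code \<tau>'"
      using Cons.prems by (cases b; cases b') (simp_all add: \<tau>, presburger+)
    then show ?case using Cons.IH \<tau> by simp
  qed
qed

lemma surj_str_code: "surj str_code"
proof -
  have "\<exists>\<sigma>. str_code \<sigma> = n" for n
  proof (induction n rule: less_induct)
    case (less n)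
    show ?case
    proof (cases "n = 0")
      case False
      then obtain \<sigma> where "str_code \<sigma> = (n - 1) div 2"
        using less.IH[of "(n - 1) div 2"] by force
      then have "str_code (even n # \<sigma>) = n"
        using False by (cases "even n") (simp_all, presburger+)
      then show ?thesis by blast
    qed simp
  qed
  then show ?thesis by (metis surjI)
qed

text \<open>The search stops at the least \<open>k\<close> such that the input is at most
  \<open>2 * k + 2\<close>. For \<open>b # \<sigma>\<close> this is
  \<open>str_code \<sigma>\<close>, whichever \<open>b\<close> is; for the empty string it is
  0.\<close>

definition tail_prog :: prog where
  "tail_prog =
    Mu (Comp monus_prog [Comp Succ [Comp Succ [Comp double_prog [Proj 0]]], Proj 1])"

definition drop_prog :: prog where
  "drop_prog = Prec (Proj 0) (Comp tail_prog [Proj 1])"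

definition length_prog :: prog where
  "length_prog = Mu drop_prog"

text \<open>The code of a nonempty string exceeds twice the code of its tail by 1 or 2, so
  subtracting 1 leaves the first bit.\<close>

definition hd_prog :: prog where
  "hd_prog = Comp pred_prog [Comp monus_prog [Comp double_prog [tail_prog], Proj 0]]"

text \<open>The string precedes the index, the order in which \<open>relativize\<close> hands
  arguments to the program answering queries.\<close>

definition nth_prog :: prog where
  "nth_prog = Comp hd_prog [Comp drop_prog [Proj 1, Proj 0]]"

definition zeros_prog :: prog where
  "zeros_prog = Prec Zero (Comp Succ [Comp double_prog [Proj 1]])"

lemma query_free_str [simp]:
  "query_free tail_prog" "query_free drop_prog" "query_free length_prog"
  "query_free hd_prog" "query_free nth_prog" "query_free zeros_prog"
  by (simp_all add: tail_prog_def drop_prog_def length_prog_def hd_prog_def nth_prog_def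
      zeros_prog_def)

lemma halts_with_tail [simp]:
  "halts_with tail_prog [str_code \<sigma>] z \<longleftrightarrow> z = str_code (tl \<sigma>)"
  unfolding tail_prog_def
  by (rule halts_with_iff,
      rule halts_with_Mu[where F = "\<lambda>k. str_code \<sigma> - Suc (Suc (2 * k))"])
    (cases \<sigma>; auto)+

lemma halts_with_drop [simp]:
  "halts_with drop_prog [k, str_code \<sigma>] z \<longleftrightarrow> z = str_code (drop k \<sigma>)"
  unfolding drop_prog_def
  by (rule halts_with_iff, rule halts_with_Prec[where r = "\<lambda>k. str_code (drop k \<sigma>)"])
    (auto simp: drop_Suc tl_drop)

lemma halts_with_length [simp]:
  "halts_with length_prog [str_code \<sigma>] z \<longleftrightarrow> z = length \<sigma>"
  unfolding length_prog_def
  by (rule halts_with_iff, rule halts_with_Mu[where F = "\<lambda>k. str_code (drop k \<sigma>)"]) auto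

lemma halts_with_hd: "\<sigma> \<noteq> [] \<Longrightarrow> halts_with hd_prog [str_code \<sigma>] (of_bool (hd \<sigma>))"
  unfolding hd_prog_def by (cases \<sigma>) (auto simp del: str_code.simps, auto)

lemma halts_with_nth:
  "i < length \<sigma> \<Longrightarrow> halts_with nth_prog [str_code \<sigma>, i] (of_bool (\<sigma> ! i))"
  unfolding nth_prog_def using halts_with_hd[of "drop i \<sigma>"] by (simp add: hd_drop_conv_nth)

lemma halts_with_zeros [simp]:
  "halts_with zeros_prog [n] z \<longleftrightarrow> z = str_code (replicate n False)"
  unfolding zeros_prog_def
  by (rule halts_with_iff,
      rule halts_with_Prec[where r = "\<lambda>k. str_code (replicate k False)"]) auto

section \<open>Simulating an oracle\<close>

text \<open>
  \<open>relativize q k e\<close> runs the \<open>k\<close>-ary oracle program \<open>e\<close> with an extra first argument \<open>c\<close>,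
  and answers a query \<open>x\<close> by the value of \<open>q\<close> on \<open>[c, x]\<close>. The arity is needed because
  permuting a list of arguments requires a projection for each of them.
\<close>

fun relativize :: "prog \<Rightarrow> nat \<Rightarrow> prog \<Rightarrow> prog" where
  "relativize q k Zero = Zero"
| "relativize q k Succ = Comp Succ [Proj 1]"
| "relativize q k (Proj i) = Proj (Suc i)"
| "relativize q k Query = q"
| "relativize q k (Comp f gs) =
    Comp (relativize q (length gs) f) (Proj 0 # map (relativize q k) gs)"
| "relativize q k (Prec f g) =
    Comp
      (Prec (relativize q (k - 1) f)
        (Comp (relativize q (Suc k) g)
          (Proj 2 # Proj 0 # Proj 1 # map Proj [3..<k + 2])))
      (Proj 1 # Proj 0 # map Proj [2..<k + 1])"
| "relativize q k (Mu f) =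
    Mu (Comp (relativize q (Suc k) f) (Proj 1 # Proj 0 # map Proj [2..<k + 2]))"

lemma query_free_relativize: "query_free q \<Longrightarrow> query_free (relativize q k e)"
  by (induction q k e rule: relativize.induct) (auto simp: list_all_iff)

text \<open>Evaluates the projections with which \<open>relativize\<close> passes on the unpermuted
  arguments.\<close>

lemma halts_with_Projs:
  assumes "l = length zs"
  shows "list_all2 (\<lambda>g. halts_with g zs) (map Proj [m..<l]) ws \<longleftrightarrow> ws = drop m zs"
  using assms by (auto simp: list_all2_conv_all_nth intro: nth_equalityI)

text \<open>Induction on the computation, whose subcomputations query only bits in \<open>Q\<close>.
  Hence \<open>q\<close> has to be right only on \<open>Q\<close>, which is why an initial segment
  of the oracle can serve as \<open>c\<close>.\<close>

lemma halts_with_relativize: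
  assumes "computes X e xs y Q"
    and "\<And>x. x \<in> Q \<Longrightarrow> halts_with q [c, x] (of_bool (X x))"
  shows "halts_with (relativize q (length xs) e) (c # xs) y"
  using assms
proof (induction rule: computes.induct)
  case (comp ys gs Qs xs f y Q)
  have "list_all2 (\<lambda>g. halts_with g (c # xs)) (map (relativize q (length xs)) gs) ys"
    unfolding list_all2_conv_all_nth
  proof (intro conjI allI impI)
    fix i assume "i < length (map (relativize q (length xs)) gs)"
    then have i: "i < length gs" by simp
    then have "halts_with q [c, x] (of_bool (X x))" if "x \<in> Qs ! i" for x
      using that comp.prems[of x] comp.hyps(2) by force
    with i show "halts_with (map (relativize q (length xs)) gs ! i) (c # xs) (ys ! i)"
      using comp.IH(1) by simp
  qed (use comp.hyps in simp)
  moreover have "halts_with (relativize q (length gs) f) (c # ys) y"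
    using comp.IH(2) comp.prems comp.hyps(1) by simp
  ultimately show ?case by auto
next
  case (prec_0 f xs y Q g)
  then have "halts_with (relativize q (length xs) f) (c # xs) y" by simp
  then have "halts_with (Prec (relativize q (length xs) f) g') (0 # c # xs) y" for g'
    by (rule halts_with_Prec[where r = "\<lambda>_. y"]) simp
  then show ?case by (simp add: halts_with_Projs del: upt_Suc)
next
  case (prec_Suc f g n xs r Q y Q')
  \<comment> \<open>\<open>Prec\<close> must see its recursion argument first, so \<open>c\<close>
    moves behind it. The step receives \<open>n # r # c # xs\<close>, and the projections 2, 0, 1
    bring \<open>c\<close> back to the front.\<close>
  let ?g = "Comp (relativize q (Suc (length (n # xs))) g)
    (Proj 2 # Proj 0 # Proj 1 # map Proj [3..<length (n # xs) + 2])"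
  let ?P = "Prec (relativize q (length xs) f) ?g"
  have 1: "halts_with ?P (n # c # xs) r"
    using prec_Suc.IH(1) prec_Suc.prems by (simp add: halts_with_Projs del: upt_Suc)
  have 2: "halts_with ?g (n # r # c # xs) y"
    using prec_Suc.IH(2) prec_Suc.prems by (simp add: halts_with_Projs del: upt_Suc)
  have "halts_with ?P (Suc n # c # xs) y"
    using computes.prec_Suc[OF 1[unfolded halts_with_def] 2[unfolded halts_with_def]]
    by (simp add: halts_with_def)
  then show ?case by (simp add: halts_with_Projs del: upt_Suc)
next
  case (mu n f xs r Q)
  \<comment> \<open>Here too the search variable precedes \<open>c\<close>, and the first two
    projections swap them.\<close>
  let ?f = "Comp (relativize q (Suc (length xs)) f)
    (Proj 1 # Proj 0 # map Proj [2..<length xs + 2])"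
  have run: "halts_with ?f (k # c # xs) z"
    if "halts_with (relativize q (Suc (length xs)) f) (c # k # xs) z" for k z
    using that by (simp add: halts_with_Projs del: upt_Suc)
  have "halts_with (Mu ?f) (c # xs) n"
  proof (rule halts_with_Mu[where F = "\<lambda>k. if k = n then 0 else Suc (r k)"])
    show "halts_with ?f (k # c # xs) (if k = n then 0 else Suc (r k))" if "k \<le> n" for k
    proof (rule run)
      show "halts_with (relativize q (Suc (length xs)) f) (c # k # xs)
        (if k = n then 0 else Suc (r k))"
        using that mu.IH(1)[of k] mu.IH(2) mu.prems by (cases "k = n") auto
    qed
  qed auto
  then show ?case by (simp del: upt_Suc)
qed auto

section \<open>Composition with recursive functions\<close>

lemma recursive_funE:
  assumes "recursive_fun f"
  obtains e where "query_free e" "\<And>x z. halts_with e [x] z \<longleftrightarrow> z = f x"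
proof -
  obtain e where "query_free e" "\<And>xs. length xs = 1 \<Longrightarrow> halts_with e xs (f (xs ! 0))"
    using assms unfolding recursive_fun_def recursive_def by blast
  then show thesis
    using that[of e] halts_with_iff[of e "[_]"] by force
qed

lemma recursive_funI:
  assumes "query_free e" and "\<And>x. halts_with e [x] (f x)"
  shows "recursive_fun f"
  unfolding recursive_fun_def recursive_def
  using assms by (intro exI[of _ e]) (auto simp: length_Suc_conv)

text \<open>Entries 0 and 1 are the quantified variables of \<open>Sigma02\<close> and
  \<open>Pi02\<close>, entry 2 is the argument of the function and entry 3 its value.\<close>

lemma recursive_rel_substitute:
  assumes "recursive_rel 4 P" and "recursive_fun u"
  shows "recursive_rel 4 (\<lambda>xs. P [xs ! 0, xs ! 1, u (xs ! 2), xs ! 3])"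
proof -
  obtain e where e: "query_free e" "\<And>xs. length xs = 4 \<Longrightarrow> halts_with e xs (of_bool (P xs))"
    using assms(1) unfolding recursive_rel_def recursive_def by blast
  obtain d where d: "query_free d" "\<And>x z. halts_with d [x] z \<longleftrightarrow> z = u x"
    using assms(2) by (rule recursive_funE) blast
  show ?thesis
    unfolding recursive_rel_def recursive_def
    by (rule exI[of _ "Comp e [Proj 0, Proj 1, Comp d [Proj 2], Proj 3]"])
      (use e d in auto)
qed

text \<open>Substituting \<open>u\<close> into the matrix of either quantifier form of the graph of
  \<open>g\<close> gives the same form for the composition.\<close>

lemma Delta02_fun_compose:
  assumes "Delta02_fun g" and "recursive_fun u"
  shows "Delta02_fun (\<lambda>n. g (u n))"
proof -
  obtain P where P: "recursive_rel 4 P" "\<And>x y. g x = y \<longleftrightarrow> (\<exists>a. \<forall>b. P [a, b, x, y])"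
    using assms(1) unfolding Delta02_fun_def Sigma02_def by blast
  obtain P' where P': "recursive_rel 4 P'" "\<And>x y. g x = y \<longleftrightarrow> (\<forall>a. \<exists>b. P' [a, b, x, y])"
    using assms(1) unfolding Delta02_fun_def Pi02_def by blast
  show ?thesis
    unfolding Delta02_fun_def Sigma02_def Pi02_def
  proof (intro conjI exI)
    show "\<forall>x y. g (u x) = y \<longleftrightarrow>
      (\<exists>a. \<forall>b. (\<lambda>xs. P [xs ! 0, xs ! 1, u (xs ! 2), xs ! 3]) [a, b, x, y])"
      by (simp add: P(2))
    show "\<forall>x y. g (u x) = y \<longleftrightarrow>
      (\<forall>a. \<exists>b. (\<lambda>xs. P' [xs ! 0, xs ! 1, u (xs ! 2), xs ! 3]) [a, b, x, y])"
      by (simp add: P'(2))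
  qed (use recursive_rel_substitute P(1) P'(1) assms(2) in blast)+
qed

section \<open>Prefix-free complexity\<close>

definition machine_of :: "prog \<Rightarrow> bool list \<Rightarrow> bool list option" where
  "machine_of e \<sigma> =
    (if \<exists>\<tau>. halts_with e [str_code \<sigma>] (str_code \<tau>)
     then Some (THE \<tau>. halts_with e [str_code \<sigma>] (str_code \<tau>)) else None)"

text \<open>The choice by \<open>THE\<close> is unique because evaluation is functional and
  \<open>str_code\<close> is injective.\<close>

lemma machine_of_eq_Some_iff:
  "machine_of e \<sigma> = Some \<tau> \<longleftrightarrow> halts_with e [str_code \<sigma>] (str_code \<tau>)"
proof -
  have "(THE \<tau>. halts_with e [str_code \<sigma>] (str_code \<tau>)) = \<tau>"
    if "halts_with e [str_code \<sigma>] (str_code \<tau>)" for \<tau>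
    using that by (rule the_equality) (metis that halts_with_iff inj_str_code injD)
  then show ?thesis by (auto simp: machine_of_def)
qed

lemma partial_recursive_machine_of: "query_free e \<Longrightarrow> partial_recursive_str (machine_of e)"
  unfolding partial_recursive_str_def using machine_of_eq_Some_iff by blast

text \<open>A machine defined only on the empty string, with output \<open>\<tau>\<close>, is
  prefix-free, so \<open>U\<close> simulates it.\<close>

lemma universal_surj:
  assumes "universal_prefix_free_machine U"
  obtains \<sigma> where "U \<sigma> = Some \<tau>"
proof -
  \<comment> \<open>The search succeeds only on the empty string, whose code is 0.\<close>
  let ?e = "Mu (Comp add_prog [Proj 1, Comp monus_prog [Proj 0, const_prog (str_code \<tau>)]])"
  have "halts_with ?e [str_code []] (str_code \<tau>)"
    by (rule halts_with_Mu[where F = "\<lambda>k. str_code \<tau> - k"]) auto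
  then have 1: "machine_of ?e [] = Some \<tau>"
    by (simp only: machine_of_eq_Some_iff)
  have "\<sigma> = []" if "\<sigma> \<in> dom (machine_of ?e)" for \<sigma>
    using that by (auto simp: machine_of_eq_Some_iff dest!: halts_with_MuD)
  then have "prefix_free_machine (machine_of ?e)"
    unfolding prefix_free_machine_def by (auto intro: partial_recursive_machine_of)
  then show thesis
    using assms 1 that unfolding universal_prefix_free_machine_def by metis
qed

lemma K_le: "U \<sigma> = Some \<tau> \<Longrightarrow> K U \<tau> \<le> length \<sigma>"
  unfolding K_def by (rule Least_le) blast

lemma K_attained:
  assumes "universal_prefix_free_machine U"
  obtains \<sigma> where "U \<sigma> = Some \<tau>" "length \<sigma> = K U \<tau>"
proof -
  obtain \<sigma> where "U \<sigma> = Some \<tau>" using assms by (rule universal_surj)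
  then have "\<exists>k \<sigma>. U \<sigma> = Some \<tau> \<and> length \<sigma> = k" by blast
  from LeastI_ex[OF this] show thesis using that unfolding K_def by blast
qed

text \<open>Running \<open>e\<close> on outputs of \<open>U\<close> can only shrink the domain, so
  the composite stays prefix-free. The prefix by which \<open>U\<close> simulates it has a fixed
  length, which is \<open>c\<close>.\<close>

lemma K_partial_recursive_image:
  assumes U: "universal_prefix_free_machine U" and e: "query_free e"
  obtains c where
    "\<And>\<rho> \<tau>. halts_with e [str_code \<rho>] (str_code \<tau>) \<Longrightarrow> K U \<tau> \<le> K U \<rho> + c"
proof -
  obtain d where d: "query_free d"
    "\<And>\<sigma> \<tau>. U \<sigma> = Some \<tau> \<longleftrightarrow> halts_with d [str_code \<sigma>] (str_code \<tau>)"
    using U unfolding universal_prefix_free_machine_def prefix_free_machine_def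
      partial_recursive_str_def by blast
  let ?M = "machine_of (Comp e [d])"
  \<comment> \<open>Surjectivity of \<open>str_code\<close> makes the intermediate number a code,
    hence the code of an output of \<open>U\<close>.\<close>
  have M: "?M \<sigma> = Some \<tau> \<longleftrightarrow> (\<exists>\<rho>. U \<sigma> = Some \<rho> \<and> halts_with e [str_code \<rho>] (str_code \<tau>))"
    for \<sigma> \<tau>
    unfolding machine_of_eq_Some_iff d(2) by (auto, metis surj_str_code surjD)
  have "dom ?M \<subseteq> dom U" by (auto simp: M)
  then have "prefix_free_machine ?M"
    using U d(1) e partial_recursive_machine_of[of "Comp e [d]"]
    unfolding universal_prefix_free_machine_def prefix_free_machine_def by (auto simp: subset_iff)
  then obtain \<pi> where \<pi>: "\<And>\<sigma>. U (\<pi> @ \<sigma>) = ?M \<sigma>"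
    using U unfolding universal_prefix_free_machine_def by blast
  show thesis
  proof
    fix \<rho> \<tau> assume *: "halts_with e [str_code \<rho>] (str_code \<tau>)"
    obtain \<sigma> where \<sigma>: "U \<sigma> = Some \<rho>" "length \<sigma> = K U \<rho>"
      using U by (rule K_attained)
    then have "U (\<pi> @ \<sigma>) = Some \<tau>" using * by (auto simp: \<pi> M)
    from K_le[of U, OF this] show "K U \<tau> \<le> K U \<rho> + length \<pi>" by (simp add: \<sigma>(2))
  qed
qed

section \<open>Bounded use\<close>

text \<open>\<open>Suc\<close> serves twice: the sums increase strictly, and each \<open>f i\<close>
  with \<open>i < n\<close> is below the bound, so an initial segment of that length contains bit
  \<open>f i\<close>.\<close>

definition use_bound :: "(nat \<Rightarrow> nat) \<Rightarrow> nat \<Rightarrow> nat" where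
  "use_bound f n = (\<Sum>i<n. Suc (f i))"

text \<open>Lower adjoint of \<open>use_bound f\<close>; strict monotonicity makes it a left
  inverse.\<close>

definition use_index :: "(nat \<Rightarrow> nat) \<Rightarrow> nat \<Rightarrow> nat" where
  "use_index f m = (LEAST k. m \<le> use_bound f k)"

lemma strict_mono_use_bound: "strict_mono (use_bound f)"
  by (simp add: strict_mono_Suc_iff use_bound_def)

lemma less_use_bound: "i < n \<Longrightarrow> f i < use_bound f n"
  unfolding use_bound_def
  using member_le_sum[of i "{..<n}" "\<lambda>i. Suc (f i)"] by simp

lemma le_use_bound_use_index: "m \<le> use_bound f (use_index f m)"
  unfolding use_index_def
  \<comment> \<open>The witness \<open>m\<close> works since a strictly increasing function on the
    naturals dominates the identity.\<close>
  by (rule LeastI[of _ m]) (simp add: strict_mono_imp_increasing strict_mono_use_bound)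

lemma use_index_le: "m \<le> use_bound f k \<Longrightarrow> use_index f m \<le> k"
  unfolding use_index_def by (rule Least_le)

lemma use_index_use_bound [simp]: "use_index f (use_bound f n) = n"
  using strict_mono_use_bound[of f]
  by (intro antisym use_index_le order_refl)
    (metis le_use_bound_use_index strict_mono_less_eq)

lemma mono_use_index: "mono (use_index f)"
  by (meson monoI order_trans use_index_le le_use_bound_use_index)

lemma recursive_use_bound:
  assumes "recursive_fun f"
  shows "recursive_fun (use_bound f)"
proof -
  obtain e where e: "query_free e" "\<And>x z. halts_with e [x] z \<longleftrightarrow> z = f x"
    using assms by (rule recursive_funE) blast
  show ?thesis
  proof (rule recursive_funI)
    show "halts_with (Prec Zero (Comp Succ [Comp add_prog [Proj 1, Comp e [Proj 0]]])) [n]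
      (use_bound f n)" for n
      by (rule halts_with_Prec) (auto simp: use_bound_def e)
  qed (simp add: e)
qed

lemma recursive_use_index:
  assumes "recursive_fun f"
  shows "recursive_fun (use_index f)"
proof -
  obtain e where e: "query_free e" "\<And>x z. halts_with e [x] z \<longleftrightarrow> z = use_bound f x"
    using recursive_use_bound[OF assms] by (rule recursive_funE) blast
  show ?thesis
  proof (rule recursive_funI)
    show "halts_with (Mu (Comp monus_prog [Comp e [Proj 0], Proj 1])) [m] (use_index f m)" for m
      by (rule halts_with_Mu[where F = "\<lambda>k. m - use_bound f k"])
        (auto simp: e le_use_bound_use_index dest: use_index_le simp flip: not_le)
  qed (simp add: e)
qed

text \<open>Use principle: \<open>nth_prog\<close> answers every query from the segment.\<close>

lemma halts_with_relativize_initial_segment: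
  assumes "computes X e [i] y Q" and "\<And>x. x \<in> Q \<Longrightarrow> x < m"
  shows "halts_with (relativize nth_prog 1 e) [str_code (initial_segment X m), i] y"
proof -
  have "halts_with nth_prog [str_code (initial_segment X m), x] (of_bool (X x))" if "x \<in> Q" for x
    using halts_with_nth[of x "initial_segment X m"] assms(2)[OF that]
    by (simp add: initial_segment_def)
  from halts_with_relativize[OF assms(1) this] show ?thesis by simp
qed

text \<open>The input length determines \<open>n\<close> through \<open>use_index\<close>, so one
  program serves all \<open>n\<close>. It builds the segment from its last bit backwards, since
  prepending a bit is arithmetic on codes.\<close>

lemma wtt_initial_segment:
  assumes f: "recursive_fun f"
    and \<Phi>: "\<And>n. \<exists>Q. computes B \<Phi> [n] (of_bool (A n)) Q \<and> (\<forall>q\<in>Q. q \<le> f n)"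
  obtains e where "query_free e"
    "\<And>n. halts_with e [str_code (initial_segment B (use_bound f n))]
      (str_code (initial_segment A n))"
proof -
  obtain u where u: "query_free u" "\<And>x z. halts_with u [x] z \<longleftrightarrow> z = use_index f x"
    using recursive_use_index[OF f] by (rule recursive_funE) blast
  \<comment> \<open>The step sees \<open>[k, r, n, c]\<close>, where \<open>r\<close> codes the last
    \<open>k\<close> bits and \<open>c\<close> the segment of \<open>B\<close>; the next bit to
    prepend has index \<open>n - k - 1\<close>.\<close>
  let ?bit = "Comp (relativize nth_prog 1 \<Phi>)
    [Proj 3, Comp pred_prog [Comp monus_prog [Proj 0, Proj 2]]]"
  \<comment> \<open>Prepending a bit \<open>b\<close> turns the code \<open>r\<close> into
    \<open>2 * r + b + 1\<close>.\<close>
  let ?step = "Comp Succ [Comp add_prog [Comp double_prog [Proj 1], ?bit]]"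
  \<comment> \<open>The recursion depth and the parameter \<open>n\<close> both come from the input
    length.\<close>
  let ?e = "Comp (Prec Zero ?step)
    [Comp u [length_prog], Comp u [length_prog], Proj 0]"
  have "halts_with ?e [str_code (initial_segment B (use_bound f n))]
      (str_code (initial_segment A n))" for n
  proof -
    let ?c = "str_code (initial_segment B (use_bound f n))"
    have bit: "halts_with (relativize nth_prog 1 \<Phi>) [?c, i] (of_bool (A i))" if "i < n" for i
    proof -
      obtain Q where "computes B \<Phi> [i] (of_bool (A i)) Q" "\<forall>q\<in>Q. q \<le> f i"
        using \<Phi> by blast
      then show ?thesis
        using less_use_bound[OF that, of f]
        by (intro halts_with_relativize_initial_segment) auto
    qed
    let ?r = "\<lambda>k. str_code (drop (n - k) (initial_segment A n))"
    have "halts_with (Prec Zero ?step) [n, n, ?c] (?r n)"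
    proof (rule halts_with_Prec[where r = ?r])
      fix k assume "k < n"
      then have "?r (Suc k) = Suc (2 * ?r k + of_bool (A (n - Suc k)))"
        using Cons_nth_drop_Suc[of "n - Suc k" "initial_segment A n"]
        by (simp add: initial_segment_def Suc_diff_Suc flip: Cons_nth_drop_Suc)
      then show "halts_with ?step [k, ?r k, n, ?c] (?r (Suc k))"
        using halts_with_iff[OF bit, of "n - Suc k"] \<open>k < n\<close> by (simp add: numeral_3_eq_3)
    qed (simp add: initial_segment_def)
    then show ?thesis by (simp add: u initial_segment_def)
  qed
  moreover have "query_free ?e" by (simp add: u query_free_relativize)
  ultimately show thesis using that by blast
qed

theorem theorem3p1:
  fixes U :: "bool list \<Rightarrow> bool list option" and A B :: "nat \<Rightarrow> bool"
  assumes "universal_prefix_free_machine U"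
    and "A \<le>\<^sub>w\<^sub>t\<^sub>t B"
    and "B \<in> KT_Delta02 U"
  shows "A \<in> KT_Delta02 U"
proof -
  obtain \<Phi> f where f: "recursive_fun f"
    and \<Phi>: "\<And>n. \<exists>Q. computes B \<Phi> [n] (of_bool (A n)) Q \<and> (\<forall>q\<in>Q. q \<le> f n)"
    using assms(2) unfolding wtt_reducible_def by blast
  obtain d where d: "query_free d"
    "\<And>n. halts_with d [str_code (initial_segment B (use_bound f n))]
      (str_code (initial_segment A n))"
    using f \<Phi> by (rule wtt_initial_segment) blast
  obtain e where e: "query_free e" "\<And>x z. halts_with e [x] z \<longleftrightarrow> z = use_bound f x"
    using recursive_use_bound[OF f] by (rule recursive_funE) blast
  \<comment> \<open>Turns a string of \<open>n\<close> zeros into one of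
    \<open>use_bound f n\<close> zeros, which bounds the complexity of the new length by that of
    \<open>n\<close>.\<close>
  let ?e = "Comp zeros_prog [Comp e [length_prog]]"
  have zeros: "halts_with ?e [str_code (replicate n False)]
    (str_code (replicate (use_bound f n) False))" for n
    by (simp add: e)
  obtain c where c: "\<And>n. K U (initial_segment A n) \<le> K U (initial_segment B (use_bound f n)) + c"
    using K_partial_recursive_image[OF assms(1) d(1)] d(2) by metis
  have "query_free ?e" by (simp add: e)
  from K_partial_recursive_image[OF assms(1) this] zeros obtain c' where
    c': "\<And>n. K U (replicate (use_bound f n) False) \<le> K U (replicate n False) + c'"
    by metis
  have "A \<in> KT U g" if g: "is_order g" "Delta02_fun g" for g
  proof -
    \<comment> \<open>Chosen to take the value \<open>g n\<close> at \<open>use_bound f n\<close>,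
      which also makes it unbounded.\<close>
    let ?h = "\<lambda>m. g (use_index f m)"
    have "Delta02_fun ?h"
      using g(2) recursive_use_index[OF f] by (rule Delta02_fun_compose)
    moreover have "is_order ?h"
      using g(1) mono_use_index[of f] unfolding is_order_def
      by (metis (no_types, lifting) monoD monoI use_index_use_bound)
    ultimately have "B \<in> KT U ?h"
      using assms(3) unfolding KT_Delta02_def by blast
    then obtain b where b: "\<And>n. K U (initial_segment B n) \<le> K U (replicate n False) + ?h n + b"
      unfolding KT_def by blast
    \<comment> \<open>Here \<open>c\<close> passes from \<open>A\<close> to \<open>B\<close>,
      \<open>b\<close> bounds \<open>B\<close> at length \<open>use_bound f n\<close>, and
      \<open>c'\<close> returns to length \<open>n\<close>.\<close>
    have "K U (initial_segment A n) \<le> K U (replicate n False) + g n + (c + c' + b)" for n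
      using c[of n] c'[of n] b[of "use_bound f n"] by simp
    then show ?thesis unfolding KT_def by blast
  qed
  then show ?thesis unfolding KT_Delta02_def by blast
qed

end
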